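(* Let $T:\ell_\infty\to\ell_\infty$ be an onto linear isometry. Then $T$ is a signed permutation operator, i.e., there exist a bijection $\sigma:\mathbb{N}\to\mathbb{N}$ and scalars $c_n\in\mathbb{K}$ with $|c_n|=1$ for every $n\in\mathbb{N}$ such that $T(x)=(c_nx_{\sigma(n)})_{n\in\mathbb{N}}$ for every $x=(x_n)_{n\in\mathbb{N}}\in\ell_\infty$.
   Context: $\mathbb{K}$ is $\mathbb{R}$ or $\mathbb{C}$, and $\ell_\infty$ is the space of bounded sequences in $\mathbb{K}$ with the supremum norm. *)

theory Defs
  imports "HOL-Analysis.Analysis"
begin

text \<open>
  The space of bounded sequences with the supremum norm is the library's normed space of bounded
  continuous functions on \<open>nat\<close>: the topology on \<open>nat\<close> is discrete, so continuity is no restriction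
  (lemma \<open>linf_iff\<close>). It is used below at \<open>real\<close> and \<open>complex\<close> scalars only.
\<close>

type_synonym 'k linf = "nat \<Rightarrow>\<^sub>C 'k"

lemma linf_iff:
  fixes f :: "nat \<Rightarrow> 'k::real_normed_field"
  shows "f \<in> bcontfun \<longleftrightarrow> bounded (range f)"
  by (simp add: bcontfun_def)

lemma norm_linf:
  fixes x :: "'k::real_normed_field linf"
  shows "norm x = (SUP n. norm (apply_bcontfun x n))"
  by (simp add: norm_bcontfun_def dist_bcontfun_def)

text \<open>
  The library provides only real scalar multiplication on this space; linearity over the complex
  numbers needs the multiplication by scalars of the field itself.
\<close>

definition scale_linf :: "'k::real_normed_field \<Rightarrow> 'k linf \<Rightarrow> 'k linf" where
  "scale_linf c x = Bcontfun (\<lambda>n. c * apply_bcontfun x n)"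

lemma apply_scale_linf [simp]:
  "apply_bcontfun (scale_linf c x) n = c * apply_bcontfun x n"
proof -
  have "bounded (range (\<lambda>n. c * apply_bcontfun x n))"
    unfolding bounded_iff
    by (auto simp: norm_mult norm_bounded intro!: mult_left_mono exI[of _ "norm c * norm x"])
  then show ?thesis
    by (simp add: scale_linf_def Bcontfun_inverse linf_iff)
qed

lemma vector_space_scale_linf: "vector_space (scale_linf :: 'k::real_normed_field \<Rightarrow> _)"
  by unfold_locales
    (auto intro!: bcontfun_eqI simp: plus_bcontfun.rep_eq algebra_simps)

lemma scale_linf_real: "scale_linf (c::real) x = c *\<^sub>R x"
  by (auto intro!: bcontfun_eqI)

definition onto_linear_isometry :: "('k::real_normed_field linf \<Rightarrow> 'k linf) \<Rightarrow> bool" where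
  "onto_linear_isometry T \<longleftrightarrow>
     Vector_Spaces.linear scale_linf scale_linf T \<and> (\<forall>x. norm (T x) = norm x) \<and> surj T"

definition signed_permutation_operator :: "('k::real_normed_field linf \<Rightarrow> 'k linf) \<Rightarrow> bool" where
  "signed_permutation_operator T \<longleftrightarrow>
     (\<exists>(\<sigma> :: nat \<Rightarrow> nat) (c :: nat \<Rightarrow> 'k). bij \<sigma> \<and> (\<forall>n. norm (c n) = 1) \<and>
        (\<forall>x n. apply_bcontfun (T x) n = c n * apply_bcontfun x (\<sigma> n)))"

end

theory Submission
  imports Defs
begin

text \<open>
  The proof tests the isometry against one geometric property of the unit vector \<open>e\<^sub>n\<close>: in a
  sequence of norm at most \<open>r\<close>, the \<open>n\<close>-th entry can be overwritten by any scalar of modulus at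
  most \<open>r\<close>, by adding a multiple of \<open>e\<^sub>n\<close>, without leaving the ball of radius \<open>r\<close>
  (\<open>norm_overwrite_le\<close>). An onto isometry \<open>T\<close> transports this property to \<open>y = T e\<^sub>n\<close>.

  If \<open>y\<close> had two nonzero entries \<open>y\<^sub>i\<close> and \<open>y\<^sub>j\<close>, take the sequence \<open>z\<close> in the unit ball with
  entry \<open>y\<^sub>i / |y\<^sub>i|\<close> at \<open>i\<close>, entry \<open>- y\<^sub>j / |y\<^sub>j|\<close> at \<open>j\<close> and \<open>0\<close> elsewhere. By the transported
  property \<open>z + (1 - s) y\<close> and \<open>z + (-1 - s) y\<close> lie in the unit ball for a common scalar \<open>s\<close>.
  The former forces \<open>s\<close> towards \<open>1\<close> through the \<open>i\<close>-th entry, the latter forces it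
  towards \<open>-1\<close> through the \<open>j\<close>-th entry, and this is impossible. Hence \<open>T e\<^sub>n\<close> is a unimodular
  multiple of a single unit vector \<open>e\<^sub>m\<close> (\<open>isometry_unit_vector\<close>).

  Since an isometry need not be determined by its values on the (non-dense) span of the unit
  vectors, the formula for general \<open>x\<close> needs the overwriting property once more: if \<open>d\<close> is the
  difference of the \<open>m\<close>-th entry of \<open>T x\<close> and \<open>c x\<^sub>n\<close>, where \<open>T e\<^sub>n = c e\<^sub>m\<close>, then
  \<open>|d + t c| \<le> \<parallel>x\<parallel>\<close> for all \<open>|t| \<le> \<parallel>x\<parallel>\<close>, and choosing \<open>t c\<close> in the direction of \<open>d\<close> gives
  \<open>d = 0\<close> (\<open>isometry_coordinate\<close>).

  The argument uses only the triangle inequality and multiplicativity of the norm, so it runs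
  over an arbitrary real normed field and settles the real and complex cases at once.
\<close>

definition unit_linf :: "nat \<Rightarrow> 'k::real_normed_field linf" where
  "unit_linf n = Bcontfun (\<lambda>m. of_bool (m = n))"

lemma apply_unit_linf [simp]:
  "apply_bcontfun (unit_linf n :: 'k::real_normed_field linf) m = of_bool (m = n)"
proof -
  have "bounded (range (\<lambda>m. of_bool (m = n) :: 'k))"
    unfolding bounded_iff by (auto intro!: exI[of _ 1])
  then show ?thesis
    by (simp add: unit_linf_def Bcontfun_inverse linf_iff)
qed

lemma norm_unit_linf [simp]: "norm (unit_linf n :: 'k::real_normed_field linf) = 1"
proof (rule antisym)
  show "norm (unit_linf n :: 'k linf) \<le> 1"
    by (rule norm_bound) simp
  show "1 \<le> norm (unit_linf n :: 'k linf)"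
    using norm_bounded[of "unit_linf n :: 'k linf" n] by simp
qed

lemma norm_overwrite_le:
  fixes x :: "'k::real_normed_field linf"
  assumes "norm x \<le> r" and "norm t \<le> r"
  shows "norm (x + scale_linf (t - apply_bcontfun x n) (unit_linf n)) \<le> r"
proof (rule norm_bound)
  fix m
  have "norm (apply_bcontfun x m) \<le> r"
    using norm_bounded[of x m] assms(1) by linarith
  then show "norm (apply_bcontfun (x + scale_linf (t - apply_bcontfun x n) (unit_linf n)) m) \<le> r"
    using assms(2) by (cases "m = n") (auto simp: plus_bcontfun.rep_eq)
qed

text \<open>
  This is the overwriting property transported along \<open>T\<close>; the scalar that \<open>t\<close> replaces is the
  \<open>n\<close>-th entry of \<open>x\<close>.
\<close>

lemma isometry_overwrite_le:
  fixes T :: "'k::real_normed_field linf \<Rightarrow> 'k linf"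
  assumes "onto_linear_isometry T" and "norm x \<le> r" and "norm t \<le> r"
  shows "norm (apply_bcontfun (T x) m
           + (t - apply_bcontfun x n) * apply_bcontfun (T (unit_linf n)) m) \<le> r"
proof -
  interpret Vector_Spaces.linear scale_linf scale_linf T
    using assms(1) by (simp add: onto_linear_isometry_def)
  let ?u = "x + scale_linf (t - apply_bcontfun x n) (unit_linf n)"
  have "norm (apply_bcontfun (T ?u) m) \<le> norm (T ?u)"
    by (rule norm_bounded)
  also have "\<dots> = norm ?u"
    using assms(1) by (simp add: onto_linear_isometry_def)
  also have "\<dots> \<le> r"
    using assms(2,3) by (rule norm_overwrite_le)
  finally show ?thesis
    by (simp add: add scale plus_bcontfun.rep_eq)
qed

text \<open>
  This is the numerical form of the conflict at two nonzero entries of \<open>T e\<^sub>n\<close>. Adding \<open>b\<close> times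
  the first element to \<open>a\<close> times the second one eliminates \<open>s\<close> and leaves \<open>a + b + 2 a b\<close>,
  which is too large.
\<close>

lemma no_common_shift:
  fixes s :: "'k::real_normed_field"
  assumes "a > 0" and "b > 0"
    and "norm (1 + (1 - s) * of_real a) \<le> 1"
    and "norm (1 + (1 + s) * of_real b) \<le> 1"
  shows False
proof -
  let ?p = "1 + (1 - s) * of_real a" and ?q = "1 + (1 + s) * of_real b"
  have "of_real b * ?p + of_real a * ?q = (of_real (a + b + 2 * a * b) :: 'k)"
    by (simp add: algebra_simps)
  then have "a + b + 2 * a * b = norm (of_real b * ?p + of_real a * ?q)"
    using assms(1,2) by (simp only: norm_of_real) simp
  also have "\<dots> \<le> norm (of_real b * ?p) + norm (of_real a * ?q)"
    by (rule norm_triangle_ineq)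
  also have "\<dots> = b * norm ?p + a * norm ?q"
    using assms(1,2) by (simp add: norm_mult)
  also have "\<dots> \<le> b * 1 + a * 1"
    using assms by (intro add_mono mult_left_mono) auto
  finally have "2 * a * b \<le> 0"
    by simp
  then show False
    using mult_pos_pos[OF assms(1,2)] by simp
qed

lemma norm_unit_direction_shift:
  fixes y w :: "'k::real_normed_field"
  assumes "y \<noteq> 0"
  shows "norm (y / of_real (norm y) + w * y) = norm (1 + w * of_real (norm y))"
proof -
  have "y / of_real (norm y) + w * y = (y / of_real (norm y)) * (1 + w * of_real (norm y))"
    using assms by (simp add: field_simps)
  then show ?thesis
    using assms by (simp add: norm_mult norm_divide)
qed

lemma isometry_unit_vector_entries:
  fixes T :: "'k::real_normed_field linf \<Rightarrow> 'k linf"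
  assumes T: "onto_linear_isometry T"
    and nz: "apply_bcontfun (T (unit_linf n)) i \<noteq> 0" "apply_bcontfun (T (unit_linf n)) j \<noteq> 0"
  shows "i = j"
proof (rule ccontr)
  assume "i \<noteq> j"
  define y where "y = apply_bcontfun (T (unit_linf n))"
  have y: "y i \<noteq> 0" "y j \<noteq> 0"
    using nz by (simp_all add: y_def)
  define z :: "'k linf" where
    "z = scale_linf (y i / of_real (norm (y i))) (unit_linf i)
         + scale_linf (- (y j / of_real (norm (y j)))) (unit_linf j)"
  have z: "apply_bcontfun z m = (if m = i then y i / of_real (norm (y i))
              else if m = j then - (y j / of_real (norm (y j))) else 0)" for m
    using \<open>i \<noteq> j\<close> by (simp add: z_def plus_bcontfun.rep_eq)
  have "norm z \<le> 1"
    using y by (intro norm_bound) (simp add: z norm_divide)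
  obtain x where x: "T x = z"
    using T by (metis onto_linear_isometry_def surjD)
  with T \<open>norm z \<le> 1\<close> have "norm x \<le> 1"
    by (metis onto_linear_isometry_def)
  define s where "s = apply_bcontfun x n"
  have ball: "norm (apply_bcontfun z m + (t - s) * y m) \<le> 1" if "norm t \<le> 1" for t m
    using isometry_overwrite_le[OF T \<open>norm x \<le> 1\<close> that, of m n] by (simp add: x s_def y_def)
  have "norm (1 + (1 - s) * of_real (norm (y i))) \<le> 1"
    using ball[of 1 i] norm_unit_direction_shift[OF y(1), of "1 - s"] by (simp add: z)
  moreover have "norm (1 + (1 + s) * of_real (norm (y j))) \<le> 1"
  proof -
    \<comment> \<open>Here the overwriting scalar is \<open>-1\<close>; the entry of \<open>z\<close> at \<open>j\<close> carries a minus sign too,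
       so the whole expression is the negative of the wanted one.\<close>
    have "apply_bcontfun z j + (- 1 - s) * y j
            = - (y j / of_real (norm (y j)) + (1 + s) * y j)"
      using \<open>i \<noteq> j\<close> by (simp add: z algebra_simps)
    then have "norm (y j / of_real (norm (y j)) + (1 + s) * y j) \<le> 1"
      using ball[of "- 1" j] by (metis norm_minus_cancel norm_one order_refl)
    then show ?thesis
      using norm_unit_direction_shift[OF y(2), of "1 + s"] by simp
  qed
  ultimately show False
    using no_common_shift[of "norm (y i)" "norm (y j)" s] y by simp
qed

lemma isometry_unit_vector:
  fixes T :: "'k::real_normed_field linf \<Rightarrow> 'k linf"
  assumes T: "onto_linear_isometry T"
  obtains m c where "norm c = 1" and "T (unit_linf n) = scale_linf c (unit_linf m)"
proof -
  have norm1: "norm (T (unit_linf n)) = 1"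
    using T by (simp add: onto_linear_isometry_def)
  have "\<exists>m. apply_bcontfun (T (unit_linf n)) m \<noteq> 0"
  proof (rule ccontr)
    assume "\<nexists>m. apply_bcontfun (T (unit_linf n)) m \<noteq> 0"
    then have "norm (T (unit_linf n)) \<le> 0"
      by (intro norm_bound) simp
    with norm1 show False
      by simp
  qed
  then obtain m where m: "apply_bcontfun (T (unit_linf n)) m \<noteq> 0"
    by blast
  define c where "c = apply_bcontfun (T (unit_linf n)) m"
  have eq: "T (unit_linf n) = scale_linf c (unit_linf m)"
    using isometry_unit_vector_entries[OF T _ m] by (intro bcontfun_eqI) (auto simp: c_def)
  have "norm c \<le> 1"
    using norm_bounded[of "T (unit_linf n)" m] norm1 by (simp add: c_def)
  moreover have "norm (T (unit_linf n)) \<le> norm c"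
    unfolding eq by (rule norm_bound) simp
  ultimately have "norm c = 1"
    using norm1 by simp
  with eq show thesis
    using that by blast
qed

text \<open>
  Writing \<open>d = w - x\<^sub>n c\<close>, where \<open>w\<close> is the \<open>m\<close>-th entry of \<open>T x\<close>, the transported overwriting
  property says that the disc of radius \<open>\<parallel>x\<parallel>\<close> around \<open>d\<close> is contained in the disc of the same
  radius around \<open>0\<close>.
\<close>

lemma isometry_coordinate:
  fixes T :: "'k::real_normed_field linf \<Rightarrow> 'k linf"
  assumes T: "onto_linear_isometry T"
    and c: "norm c = 1" and Te: "T (unit_linf n) = scale_linf c (unit_linf m)"
  shows "apply_bcontfun (T x) m = c * apply_bcontfun x n"
proof (rule ccontr)
  assume ne: "apply_bcontfun (T x) m \<noteq> c * apply_bcontfun x n"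
  define d where "d = apply_bcontfun (T x) m - c * apply_bcontfun x n"
  define t where "t = of_real (norm x / norm d) * d / c"
  have d: "d \<noteq> 0" and "c \<noteq> 0"
    using ne c by (auto simp: d_def)
  have "norm t \<le> norm x"
    using d c by (simp add: t_def norm_mult norm_divide)
  from isometry_overwrite_le[OF T order_refl this, of m n]
  have "norm (apply_bcontfun (T x) m + (t - apply_bcontfun x n) * c) \<le> norm x"
    by (simp add: Te)
  also have "apply_bcontfun (T x) m + (t - apply_bcontfun x n) * c = d + t * c"
    by (simp add: d_def algebra_simps)
  also have "d + t * c = of_real (1 + norm x / norm d) * d"
    using \<open>c \<noteq> 0\<close> by (simp add: t_def algebra_simps)
  also have "norm \<dots> = (1 + norm x / norm d) * norm d"
    by (simp only: norm_mult norm_of_real) simp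
  also have "\<dots> = norm d + norm x"
    using d by (simp add: field_simps)
  finally show False
    using d by simp
qed

text \<open>
  The map \<open>\<tau>\<close> with \<open>T e\<^sub>n = c\<^sub>n e\<^bsub>\<tau> n\<^esub>\<close> goes from input to output positions; the
  permutation in the conclusion is its inverse. Surjectivity of \<open>\<tau>\<close> comes from that of \<open>T\<close>: a preimage of \<open>e\<^sub>m\<close> has
  a nonzero entry somewhere, and its position is sent to \<open>m\<close>.
\<close>

lemma onto_linear_isometry_signed_permutation:
  fixes T :: "'k::real_normed_field linf \<Rightarrow> 'k linf"
  assumes T: "onto_linear_isometry T"
  shows "signed_permutation_operator T"
proof -
  have "\<forall>n. \<exists>m c. norm c = 1 \<and> T (unit_linf n) = scale_linf c (unit_linf m)"
    using isometry_unit_vector[OF T] by metis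
  then obtain \<tau> c where c: "\<And>n. norm (c n) = 1"
    and Te: "\<And>n. T (unit_linf n) = scale_linf (c n) (unit_linf (\<tau> n))"
    by metis
  have coord: "apply_bcontfun (T x) (\<tau> n) = c n * apply_bcontfun x n" for x n
    using isometry_coordinate[OF T c Te] .
  have c_nz: "c n \<noteq> 0" for n
    using c[of n] by auto
  have "inj \<tau>"
  proof (rule injI, rule ccontr)
    fix n n'
    assume "\<tau> n = \<tau> n'" and "n \<noteq> n'"
    then show False
      using coord[of "unit_linf n" n] coord[of "unit_linf n" n'] c_nz[of n] by simp
  qed
  moreover have "surj \<tau>"
  unfolding surj_def
  proof
    fix m
    obtain x where x: "T x = unit_linf m"
      using T by (metis onto_linear_isometry_def surjD)
    have "norm x = 1"
      using T x by (metis norm_unit_linf onto_linear_isometry_def)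
    then have "x \<noteq> 0"
      by auto
    then obtain n where "apply_bcontfun x n \<noteq> 0"
      by (metis bcontfun_eqI zero_bcontfun.rep_eq)
    then have "apply_bcontfun (unit_linf m :: 'k linf) (\<tau> n) \<noteq> 0"
      using coord[of x n] c_nz[of n] by (simp add: x)
    then show "\<exists>n. m = \<tau> n"
      by (auto split: if_splits)
  qed
  ultimately have "bij \<tau>"
    by (rule bijI)
  have "apply_bcontfun (T x) m = c (inv \<tau> m) * apply_bcontfun x (inv \<tau> m)" for x m
    using coord[of x "inv \<tau> m"] \<open>surj \<tau>\<close> by (simp add: surj_f_inv_f)
  then show ?thesis
    unfolding signed_permutation_operator_def
    using \<open>bij \<tau>\<close> c by (intro exI[of _ "inv \<tau>"] exI[of _ "\<lambda>m. c (inv \<tau> m)"])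
      (simp add: bij_imp_bij_inv)
qed

theorem corollary2p10:
  shows "(\<forall>T :: real linf \<Rightarrow> real linf.
            onto_linear_isometry T \<longrightarrow> signed_permutation_operator T) \<and>
         (\<forall>T :: complex linf \<Rightarrow> complex linf.
            onto_linear_isometry T \<longrightarrow> signed_permutation_operator T)"
  by (blast intro: onto_linear_isometry_signed_permutation)

end
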